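(* Let $\mathcal{D}\subseteq\mathbb{R}^d$ be a nonempty convex compact set and let $\phi$ be an $L$-smooth (possibly nonconvex) function on $\mathcal{D}$, with $x_\star\in\arg\min_{x\in\mathcal{D}}\phi(x)$. Apply the DC-FW algorithm with target accuracy $\epsilon>0$ and initial point $x_0\in\mathcal{D}$, using the decomposition $\phi=f-g$ with $$f(x)=\phi(x)+\tfrac{L}{2}\|x\|^2,\qquad g(x)=\tfrac{L}{2}\|x\|^2.$$ Then the generated sequence $\{x_t\}$ satisfies, for every $t\ge0$, $$\min_{0\le\tau\le t}\mathrm{gap}_{\mathrm{DC}}(x_\tau)\le\frac{\phi(x_0)-\phi(x_\star)}{t+1}+\frac{\epsilon}{2}.$$ In particular, the method finds an $\epsilon$-suboptimal stationary point (a point $x_\tau$ with $\mathrm{gap}_{\mathrm{DC}}(x_\tau)\le\epsilon$) after $\mathcal{O}(1/\epsilon)$ (outer) iterations. This leads to $\mathcal{O}(1/\epsilon^2)$ evaluations of $\nabla\phi$ and $\mathcal{O}(1/\epsilon^2)$ linear minimization oracle calls. The constants hidden in $\mathcal{O}(\cdot)$ do not depend on $\epsilon$.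
   Context: Conventions: $\|\cdot\|$ is the Euclidean norm. $\phi$ is $L$-smooth on $\mathcal{D}$ if it is differentiable and $\nabla\phi$ is $L$-Lipschitz on $\mathcal{D}$. With this decomposition $f$ and $g$ are convex and differentiable, $f$ is $2L$-smooth, and $\nabla g(x)=Lx$. Gap: for $y\in\mathcal{D}$, $$\mathrm{gap}_{\mathrm{DC}}(y):=\max_{x\in\mathcal{D}}\big\{f(y)-f(x)-\langle\nabla g(y),y-x\rangle\big\}.$$ DC-FW algorithm (target accuracy $\epsilon>0$, initial point $x_0\in\mathcal{D}$). For $t=0,1,2,\dots$: set $X_{t,1}=x_t$. Then for $k=1,2,\dots$: compute $S_{t,k}\in\arg\min_{x\in\mathcal{D}}\langle\nabla f(X_{t,k})-\nabla g(x_t),x\rangle$ (one call to the linear minimization oracle) and $D_{t,k}=S_{t,k}-X_{t,k}$; if $-\langle\nabla f(X_{t,k})-\nabla g(x_t),D_{t,k}\rangle\le\epsilon/2$, set $x_{t+1}=X_{t,k}$ and leave the inner loop; otherwise set $X_{t,k+1}=X_{t,k}+\eta_{t,k}D_{t,k}$. Step-size rules (any of them may be used), with $\hat\phi_t(x)=f(x)-g(x_t)-\langle\nabla g(x_t),x-x_t\rangle$ and $L_f$ a smoothness constant of $f$: $\eta_{t,k}=2/(k+1)$; or exact line search $\eta_{t,k}\in\arg\min_{\eta\in[0,1]}\hat\phi_t(X_{t,k}+\eta D_{t,k})$; or Demyanov–Rubinov $\eta_{t,k}=\min\Big\{\frac{-\langle\nabla\hat\phi_t(X_{t,k}),D_{t,k}\rangle}{L_f\|D_{t,k}\|^2},1\Big\}$.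 *)

theory Defs
  imports "HOL-Analysis.Analysis" "HOL-Library.Landau_Symbols"
begin

text \<open>
  Gradients are taken relative to \<open>D\<close>, so that a function need only be given on \<open>D\<close>. If \<open>D\<close>
  has empty interior the gradient field \<open>\<phi>'\<close> is not determined by \<open>\<phi>\<close>, hence it is a parameter;
  a two-sided gradient (\<open>GDERIV\<close>) at the points of \<open>D\<close> is a special case.
\<close>

definition gradient_on :: "'a::real_inner set \<Rightarrow> ('a \<Rightarrow> real) \<Rightarrow> ('a \<Rightarrow> 'a) \<Rightarrow> bool"
  where "gradient_on D \<phi> \<phi>' \<longleftrightarrow>
    (\<forall>x\<in>D. (\<phi> has_derivative (\<lambda>h. \<phi>' x \<bullet> h)) (at x within D))"

definition smooth_fun_on :: "real \<Rightarrow> 'a::real_inner set \<Rightarrow> ('a \<Rightarrow> real) \<Rightarrow> ('a \<Rightarrow> 'a) \<Rightarrow> bool"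
  where "smooth_fun_on L D \<phi> \<phi>' \<longleftrightarrow> gradient_on D \<phi> \<phi>' \<and> L-lipschitz_on D \<phi>'"

lemma gradient_on_half_norm_sq:
  "gradient_on D (\<lambda>x. L / 2 * (norm x)\<^sup>2) (\<lambda>x. L *\<^sub>R x)"
  unfolding gradient_on_def power2_norm_eq_inner
  by (auto intro!: derivative_eq_intros simp: inner_commute)

lemma smooth_fun_on_half_norm_sq:
  assumes "0 \<le> L"
  shows "smooth_fun_on L D (\<lambda>x. L / 2 * (norm x)\<^sup>2) (\<lambda>x. L *\<^sub>R x)"
proof -
  have "L-lipschitz_on D (\<lambda>x. L *\<^sub>R x)"
    using assms by (auto simp: lipschitz_on_def dist_norm simp flip: scaleR_diff_right)
  then show ?thesis
    unfolding smooth_fun_on_def using gradient_on_half_norm_sq by blast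
qed

lemma smooth_fun_on_add_half_norm_sq:
  assumes "smooth_fun_on L D \<phi> \<phi>'"
  shows "smooth_fun_on (2 * L) D (\<lambda>x. \<phi> x + L / 2 * (norm x)\<^sup>2) (\<lambda>x. \<phi>' x + L *\<^sub>R x)"
proof -
  have "0 \<le> L"
    using assms by (auto simp: smooth_fun_on_def lipschitz_on_def)
  then have g: "smooth_fun_on L D (\<lambda>x. L / 2 * (norm x)\<^sup>2) (\<lambda>x. L *\<^sub>R x)"
    by (rule smooth_fun_on_half_norm_sq)
  have "gradient_on D (\<lambda>x. \<phi> x + L / 2 * (norm x)\<^sup>2) (\<lambda>x. \<phi>' x + L *\<^sub>R x)"
    unfolding gradient_on_def inner_add_left
  proof (rule ballI, rule has_derivative_add)
    fix x assume "x \<in> D"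
    then show "(\<phi> has_derivative (\<lambda>h. \<phi>' x \<bullet> h)) (at x within D)"
      and "((\<lambda>x. L / 2 * (norm x)\<^sup>2) has_derivative (\<lambda>h. (L *\<^sub>R x) \<bullet> h)) (at x within D)"
      using assms g unfolding smooth_fun_on_def gradient_on_def by blast+
  qed
  moreover have "(L + L)-lipschitz_on D (\<lambda>x. \<phi>' x + L *\<^sub>R x)"
    using assms g by (intro lipschitz_on_add) (simp_all only: smooth_fun_on_def)
  ultimately show ?thesis
    unfolding smooth_fun_on_def mult_2 ..
qed

text \<open>
  On a nonempty compact \<open>D\<close> with \<open>f\<close> continuous on \<open>D\<close> the supremum is attained, i.e. a maximum.
\<close>

definition gap_DC :: "'a::real_inner set \<Rightarrow> ('a \<Rightarrow> real) \<Rightarrow> ('a \<Rightarrow> 'a) \<Rightarrow> 'a \<Rightarrow> real"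
  where "gap_DC D f g' y = (SUP x\<in>D. f y - f x - g' y \<bullet> (y - x))"

definition dc_surrogate ::
    "('a::real_inner \<Rightarrow> real) \<Rightarrow> ('a \<Rightarrow> real) \<Rightarrow> ('a \<Rightarrow> 'a) \<Rightarrow> 'a \<Rightarrow> 'a \<Rightarrow> real"
  where "dc_surrogate f g g' y x = f x - g y - g' y \<bullet> (x - y)"

datatype step_rule = Open_Loop | Exact_Line_Search | Demyanov_Rubinov

text \<open>
  \<open>step_size rule Lf f f' g g' y k X d \<eta>\<close>: \<open>\<eta>\<close> is a legal step in inner iteration \<open>k\<close> from
  \<open>X\<close> in direction \<open>d\<close>, for the surrogate linearised at \<open>y\<close>, whose gradient at \<open>X\<close> is
  \<open>f' X - g' y\<close>. The number \<open>Lf\<close> is only used by the Demyanov--Rubinov rule.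
\<close>

fun step_size :: "step_rule \<Rightarrow> real \<Rightarrow> ('a::real_inner \<Rightarrow> real) \<Rightarrow> ('a \<Rightarrow> 'a) \<Rightarrow> ('a \<Rightarrow> real)
    \<Rightarrow> ('a \<Rightarrow> 'a) \<Rightarrow> 'a \<Rightarrow> nat \<Rightarrow> 'a \<Rightarrow> 'a \<Rightarrow> real \<Rightarrow> bool"
  where
    "step_size Open_Loop Lf f f' g g' y k X d \<eta> \<longleftrightarrow> \<eta> = 2 / (real k + 1)"
  | "step_size Exact_Line_Search Lf f f' g g' y k X d \<eta> \<longleftrightarrow>
       is_arg_min (\<lambda>s. dc_surrogate f g g' y (X + s *\<^sub>R d)) (\<lambda>s. s \<in> {0..1}) \<eta>"
  | "step_size Demyanov_Rubinov Lf f f' g g' y k X d \<eta> \<longleftrightarrow>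
       \<eta> = min (- ((f' X - g' y) \<bullet> d) / (Lf * (norm d)\<^sup>2)) 1"

definition inner_stop :: "('a::real_inner \<Rightarrow> 'a) \<Rightarrow> ('a \<Rightarrow> 'a) \<Rightarrow> real
    \<Rightarrow> (nat \<Rightarrow> 'a) \<Rightarrow> (nat \<Rightarrow> nat \<Rightarrow> 'a) \<Rightarrow> (nat \<Rightarrow> nat \<Rightarrow> 'a) \<Rightarrow> nat \<Rightarrow> nat \<Rightarrow> bool"
  where "inner_stop f' g' \<epsilon> x X S t k \<longleftrightarrow>
    - ((f' (X t k) - g' (x t)) \<bullet> (S t k - X t k)) \<le> \<epsilon> / 2"

text \<open>
  A run consists of the outer iterates \<open>x t\<close>, the inner iterates \<open>X t k\<close> and the oracle answers
  \<open>S t k\<close>, with \<open>k\<close> counted from 1. Inner iteration \<open>k\<close> is constrained only if no earlier one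
  met the stopping test. Termination of the inner loops is not built in: if loop \<open>t\<close>
  never stops, then \<open>x (Suc t)\<close> is unconstrained, so that such an execution is also a run.
\<close>

definition dc_fw_run :: "'a::real_inner set \<Rightarrow> step_rule \<Rightarrow> real \<Rightarrow> ('a \<Rightarrow> real) \<Rightarrow> ('a \<Rightarrow> 'a)
    \<Rightarrow> ('a \<Rightarrow> real) \<Rightarrow> ('a \<Rightarrow> 'a) \<Rightarrow> real \<Rightarrow> 'a
    \<Rightarrow> (nat \<Rightarrow> 'a) \<Rightarrow> (nat \<Rightarrow> nat \<Rightarrow> 'a) \<Rightarrow> (nat \<Rightarrow> nat \<Rightarrow> 'a) \<Rightarrow> bool"
  where "dc_fw_run D rule Lf f f' g g' \<epsilon> x0 x X S \<longleftrightarrow>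
    x 0 = x0 \<and>
    (\<forall>t. X t 1 = x t) \<and>
    (\<forall>t k. 1 \<le> k \<and> (\<forall>j\<in>{1..<k}. \<not> inner_stop f' g' \<epsilon> x X S t j) \<longrightarrow>
       is_arg_min (\<lambda>z. (f' (X t k) - g' (x t)) \<bullet> z) (\<lambda>z. z \<in> D) (S t k) \<and>
       (if inner_stop f' g' \<epsilon> x X S t k
        then x (Suc t) = X t k
        else \<exists>\<eta>. step_size rule Lf f f' g g' (x t) k (X t k) (S t k - X t k) \<eta> \<and>
               X t (Suc k) = X t k + \<eta> *\<^sub>R (S t k - X t k)))"

text \<open>
  The number of iterations of inner loop \<open>t\<close>, including the one that meets the stopping test.
  Meaningful only if the loop terminates.
\<close>

definition inner_iters :: "('a::real_inner \<Rightarrow> 'a) \<Rightarrow> ('a \<Rightarrow> 'a) \<Rightarrow> real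
    \<Rightarrow> (nat \<Rightarrow> 'a) \<Rightarrow> (nat \<Rightarrow> nat \<Rightarrow> 'a) \<Rightarrow> (nat \<Rightarrow> nat \<Rightarrow> 'a) \<Rightarrow> nat \<Rightarrow> nat"
  where "inner_iters f' g' \<epsilon> x X S t = (LEAST k. 1 \<le> k \<and> inner_stop f' g' \<epsilon> x X S t k)"

text \<open>
  The oracle queries made by the outer iterations \<open>0, \<dots>, T - 1\<close>, with repetitions: the points at
  which \<open>f'\<close> is evaluated, and the linear objectives passed to the linear minimization oracle.
  For \<open>f' = (\<lambda>x. \<phi>' x + L *\<^sub>R x)\<close> and \<open>g' = (\<lambda>x. L *\<^sub>R x)\<close>, an evaluation of \<open>f'\<close> costs one
  evaluation of \<open>\<phi>'\<close>, and \<open>g'\<close> costs none; the step-size rules need no further gradients.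
\<close>

definition grad_queries :: "('a::real_inner \<Rightarrow> 'a) \<Rightarrow> ('a \<Rightarrow> 'a) \<Rightarrow> real
    \<Rightarrow> (nat \<Rightarrow> 'a) \<Rightarrow> (nat \<Rightarrow> nat \<Rightarrow> 'a) \<Rightarrow> (nat \<Rightarrow> nat \<Rightarrow> 'a) \<Rightarrow> nat \<Rightarrow> 'a list"
  where "grad_queries f' g' \<epsilon> x X S T =
    concat (map (\<lambda>t. map (\<lambda>k. X t k) [1..<Suc (inner_iters f' g' \<epsilon> x X S t)]) [0..<T])"

definition lmo_queries :: "('a::real_inner \<Rightarrow> 'a) \<Rightarrow> ('a \<Rightarrow> 'a) \<Rightarrow> real
    \<Rightarrow> (nat \<Rightarrow> 'a) \<Rightarrow> (nat \<Rightarrow> nat \<Rightarrow> 'a) \<Rightarrow> (nat \<Rightarrow> nat \<Rightarrow> 'a) \<Rightarrow> nat \<Rightarrow> 'a list"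
  where "lmo_queries f' g' \<epsilon> x X S T =
    concat (map (\<lambda>t. map (\<lambda>k. f' (X t k) - g' (x t))
      [1..<Suc (inner_iters f' g' \<epsilon> x X S t)]) [0..<T])"

end

theory Submission imports Defs begin

text \<open>
  For every step-size rule, one inner iteration decreases the surrogate at least as much as the
  upper quadratic model with step \<open>2 / (k + 1)\<close> predicts. With \<open>h\<close> the suboptimality and \<open>G\<close> the
  Frank--Wolfe gap, \<open>h (k + 1) \<le> h k - s * G k + s\<^sup>2 * C / 2\<close> for \<open>s = 2 / (k + 1)\<close>; since
  \<open>h \<le> G\<close>, this gives \<open>h k \<le> 2 * C / (k + 1)\<close>, and summing over \<open>m \<le> k < 2 * m\<close> shows
  that some gap in that window is at most \<open>4 * C / (m + 1)\<close>. So each inner loop stops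
  after \<open>O(1 / \<epsilon>)\<close> steps at an \<open>\<epsilon> / 2\<close>-minimizer of the surrogate. Since the
  surrogate majorizes \<open>f - g\<close> and touches it at the current outer iterate, the gap there is at most the
  decrease of \<open>f - g\<close> plus \<open>\<epsilon> / 2\<close>, and this telescopes.
\<close>

section \<open>Quadratic bounds from smoothness relative to a convex set\<close>

text \<open>Gradients exist only relative to \<open>D\<close>, so the chain rule is applied within
  \<open>{0..1}\<close> and within the segment, which convexity keeps inside
  \<open>D\<close>.\<close>

lemma gradient_on_segment:
  assumes "gradient_on D f f'" "convex D" "x \<in> D" "y \<in> D" "s \<in> {0..1}"
  shows "((\<lambda>s. f (x + s *\<^sub>R (y - x))) has_real_derivative
           f' (x + s *\<^sub>R (y - x)) \<bullet> (y - x)) (at s within {0..1})"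
proof -
  let ?p = "\<lambda>s::real. x + s *\<^sub>R (y - x)"
  have "?p r \<in> D" if "r \<in> {0..1}" for r
    using convexD_alt[OF assms(2,3,4), of r] that by (simp add: algebra_simps)
  then have sub: "?p ` {0..1} \<subseteq> D" and s: "?p s \<in> D"
    using assms(5) by blast+
  have p: "(?p has_derivative (\<lambda>h. h *\<^sub>R (y - x))) (at s within {0..1})"
    by (auto intro!: derivative_eq_intros)
  have "(f has_derivative (\<lambda>h. f' (?p s) \<bullet> h)) (at (?p s) within ?p ` {0..1})"
    using assms(1) s sub unfolding gradient_on_def by (meson has_derivative_subset)
  from diff_chain_within[OF p this] show ?thesis
    by (simp add: has_field_derivative_def o_def mult_commute_abs)
qed

text \<open>Subtracting the linear and quadratic terms from \<open>f\<close> along the segment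
  leaves a function \<open>?h\<close>. Its derivative is nonpositive by the Lipschitz bound and
  Cauchy-Schwarz, so \<open>?h\<close> does not increase from 0 to 1.\<close>

lemma smooth_fun_on_upper_bound:
  assumes "smooth_fun_on M D f f'" "convex D" "x \<in> D" "y \<in> D"
  shows "f y \<le> f x + f' x \<bullet> (y - x) + M / 2 * (norm (y - x))\<^sup>2"
proof -
  let ?p = "\<lambda>s::real. x + s *\<^sub>R (y - x)"
  let ?h = "\<lambda>s. f (?p s) - s * (f' x \<bullet> (y - x)) - M / 2 * s\<^sup>2 * (norm (y - x))\<^sup>2"
  let ?h' = "\<lambda>s. f' (?p s) \<bullet> (y - x) - f' x \<bullet> (y - x) - M * s * (norm (y - x))\<^sup>2"
  have grad: "gradient_on D f f'" and lip: "M-lipschitz_on D f'"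
    using assms(1) by (auto simp: smooth_fun_on_def)
  have deriv: "(?h has_real_derivative ?h' s) (at s within {0..1})" if "s \<in> {0..1}" for s
    using gradient_on_segment[OF grad assms(2,3,4) that]
    by (auto intro!: derivative_eq_intros)
  have nonpos: "?h' s \<le> 0" if "s \<in> {0..1}" for s
  proof -
    have "?p s \<in> D"
      using convexD_alt[OF assms(2,3,4), of s] that by (simp add: algebra_simps)
    then have "norm (f' (?p s) - f' x) \<le> M * norm (s *\<^sub>R (y - x))"
      using lipschitz_onD[OF lip, of "?p s" x] assms(3) by (simp add: dist_norm)
    then have "norm (f' (?p s) - f' x) * norm (y - x) \<le> M * norm (s *\<^sub>R (y - x)) * norm (y - x)"
      by (rule mult_right_mono) simp
    moreover have "(f' (?p s) - f' x) \<bullet> (y - x) \<le> norm (f' (?p s) - f' x) * norm (y - x)"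
      by (rule norm_cauchy_schwarz)
    ultimately show ?thesis
      using that by (simp add: inner_diff_left power2_eq_square mult.assoc)
  qed
  have "?h 1 \<le> ?h 0"
  \<comment> \<open>The derivative within \<open>{0..1}\<close> is two-sided only at interior
    points; continuity handles the endpoints.\<close>
  proof (rule DERIV_nonpos_imp_decreasing_open[of 0 1 ?h])
    show "continuous_on {0..1} ?h"
      using deriv by (meson DERIV_continuous continuous_on_eq_continuous_within)
    fix s :: real assume s: "0 < s" "s < 1"
    then have "(?h has_real_derivative ?h' s) (at s)"
      using deriv[of s] at_within_Icc_at[of 0 s 1] by simp
    then show "\<exists>z. (?h has_real_derivative z) (at s) \<and> z \<le> 0"
      using nonpos[of s] s by force
  qed simp
  then show ?thesis by simp
qed

lemma smooth_fun_on_lower_bound: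
  assumes "smooth_fun_on M D f f'" "convex D" "x \<in> D" "y \<in> D"
  shows "f x + f' x \<bullet> (y - x) - M / 2 * (norm (y - x))\<^sup>2 \<le> f y"
proof -
  have "smooth_fun_on M D (\<lambda>x. - f x) (\<lambda>x. - f' x)"
    using assms(1) unfolding smooth_fun_on_def gradient_on_def inner_minus_left
    by (auto intro: has_derivative_minus lipschitz_on_minus)
  from smooth_fun_on_upper_bound[OF this assms(2-4)] show ?thesis by simp
qed

text \<open>The second-order expansion of \<open>g\<close> is exact. Its quadratic remainder
  compensates the possible concavity of \<phi> in \<open>f\<close>, and dropping it when
  \<open>L\<close> is nonnegative gives the convexity inequality for \<open>g\<close>.\<close>

lemma norm_sq_expand:
  fixes x y :: "'a::real_inner"
  shows "L / 2 * (norm y)\<^sup>2 = L / 2 * (norm x)\<^sup>2 + (L *\<^sub>R x) \<bullet> (y - x) + L / 2 * (norm (y - x))\<^sup>2"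
  by (simp add: power2_norm_eq_inner inner_diff inner_commute field_simps)

text \<open>First-order convexity of \<open>f\<close>: the loss
  \<open>L / 2 * (norm (y - x))\<^sup>2\<close> in the lower bound for \<phi> cancels against the
  remainder of the squared norm.\<close>

lemma add_half_norm_sq_gradient_ineq:
  assumes "smooth_fun_on L D \<phi> \<phi>'" "convex D" "x \<in> D" "y \<in> D"
  shows "\<phi> x + L / 2 * (norm x)\<^sup>2 + (\<phi>' x + L *\<^sub>R x) \<bullet> (y - x) \<le> \<phi> y + L / 2 * (norm y)\<^sup>2"
  using smooth_fun_on_lower_bound[OF assms] norm_sq_expand[of L y x]
  unfolding inner_add_left by linarith

section \<open>Scalar estimates for Frank-Wolfe steps\<close>

text \<open>Shaped for a proof by contradiction, with \<delta> to be half the accuracy. The m steps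
  of the window lower \<open>h\<close> by more than
  \<open>\<delta> - 2 * C * m / (m + 1)\<^sup>2\<close>, while at most
  \<open>2 * C / (m + 1)\<close> is available at its start; the two error terms add up to at most
  \<open>4 * C / (m + 1)\<close>.\<close>

lemma frank_wolfe_gap_recurrence:
  fixes h G :: "nat \<Rightarrow> real"
  assumes step: "\<And>k. 1 \<le> k \<Longrightarrow> k < 2 * m \<Longrightarrow>
      h (Suc k) \<le> h k - 2 / (real k + 1) * G k + (2 / (real k + 1))\<^sup>2 * C / 2"
    and nonneg: "\<And>k. 1 \<le> k \<Longrightarrow> k \<le> 2 * m \<Longrightarrow> 0 \<le> h k"
    and hG: "\<And>k. 1 \<le> k \<Longrightarrow> k < 2 * m \<Longrightarrow> h k \<le> G k"
    and gap: "\<And>k. 1 \<le> k \<Longrightarrow> k < 2 * m \<Longrightarrow> \<delta> < G k"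
    and "0 \<le> C" "0 \<le> \<delta>" "2 \<le> m"
  shows "\<delta> < 4 * C / (real m + 1)"
proof -
  have contract: "h (Suc k) \<le> (1 - 2 / (real k + 1)) * h k + (2 / (real k + 1))\<^sup>2 * C / 2"
    if "1 \<le> k" "k < 2 * m" for k
  proof -
    have "2 / (real k + 1) * h k \<le> 2 / (real k + 1) * G k"
      using hG[OF that] by (intro mult_left_mono) auto
    then show ?thesis using step[OF that] by (simp add: left_diff_distrib)
  qed
  \<comment> \<open>The bound starts at \<open>h 2\<close> because nothing is known about the size
    of \<open>h 1\<close>: for k = 1 the step is 1, so the factor in front of \<open>h 1\<close>
    vanishes.\<close>
  have decay: "h (Suc k) \<le> 2 * C / (real k + 2)" if "1 \<le> k" "k < 2 * m" for k
    using that
  proof (induction k rule: nat_induct_at_least)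
    case base
    have "h 2 \<le> C / 2" using contract[of 1] base by (simp add: numeral_2_eq_2)
    then show ?case using \<open>0 \<le> C\<close> by (simp add: numeral_2_eq_2)
  next
    case (Suc k)
    define r where "r = real k"
    have r: "1 \<le> r" using Suc.hyps by (simp add: r_def)
    have IH: "h (Suc k) \<le> 2 * C / (r + 2)" using Suc by (simp add: r_def)
    have "h (Suc (Suc k)) \<le> (1 - 2 / (r + 2)) * h (Suc k) + (2 / (r + 2))\<^sup>2 * C / 2"
      using contract[of "Suc k"] Suc.prems by (simp add: r_def add.commute)
    also have "\<dots> \<le> (1 - 2 / (r + 2)) * (2 * C / (r + 2)) + (2 / (r + 2))\<^sup>2 * C / 2"
      using IH r by (intro add_right_mono mult_left_mono) (auto simp: field_simps)
    also have "\<dots> = 2 * C * (r + 1) / (r + 2)\<^sup>2"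
    proof -
      have "(1 - 2 / u) * (2 * C / u) + (2 / u)\<^sup>2 * C / 2 = 2 * C * (u - 1) / u\<^sup>2"
        if "0 < u" for u :: real
        using that by (simp add: field_simps power2_eq_square)
      from this[of "r + 2"] show ?thesis using r by simp
    qed
    also have "\<dots> \<le> 2 * C / (r + 3)"
    proof -
      have "2 * C * ((r + 1) * (r + 3)) \<le> 2 * C * (r + 2)\<^sup>2"
        using \<open>0 \<le> C\<close> by (intro mult_left_mono) (auto simp: power2_eq_square algebra_simps)
      then show ?thesis using r by (simp add: divide_le_eq le_divide_eq mult.assoc)
    qed
    finally show ?case by (simp add: r_def add.commute)
  qed
  \<comment> \<open>A decrease guaranteed at each step of the window: there
    \<open>2 / (k + 1)\<close> lies between \<open>1 / m\<close> and \<open>2 / (m + 1)\<close>, the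
    lower end serving the gap term and the upper end the quadratic error.\<close>
  define b where "b = \<delta> / real m - 2 * C / (real m + 1)\<^sup>2"
  have "h (Suc k) < h k - b" if "m \<le> k" "k < 2 * m" for k
  proof -
    have k: "1 \<le> k" using that \<open>2 \<le> m\<close> by simp
    have "1 / real m \<le> 2 / (real k + 1)"
      using that \<open>2 \<le> m\<close> by (simp add: field_simps)
    then have "\<delta> / real m \<le> 2 / (real k + 1) * \<delta>"
      using mult_right_mono[of "1 / real m" "2 / (real k + 1)" \<delta>] \<open>0 \<le> \<delta>\<close> by simp
    also have "\<dots> < 2 / (real k + 1) * G k"
      using gap[OF k that(2)] by (intro mult_strict_left_mono) auto
    finally have 1: "\<delta> / real m < 2 / (real k + 1) * G k" .
    have "(2 / (real k + 1))\<^sup>2 \<le> (2 / (real m + 1))\<^sup>2"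
      using that by (intro power_mono divide_left_mono) auto
    then have "(2 / (real k + 1))\<^sup>2 * C / 2 \<le> (2 / (real m + 1))\<^sup>2 * C / 2"
      using \<open>0 \<le> C\<close> by (intro divide_right_mono mult_right_mono) auto
    also have "\<dots> = 2 * C / (real m + 1)\<^sup>2" by (simp add: power_divide)
    finally show ?thesis using step[OF k that(2)] 1 unfolding b_def by linarith
  qed
  then have strict: "h (Suc (m + j)) < h (m + j) - b" if "j < m" for j using that by simp
  have sum: "h (m + j) \<le> h m - real j * b" if "j \<le> m" for j
    using that
  proof (induction j)
    case (Suc j)
    then show ?case using strict[of j] by (simp add: algebra_simps)
  qed simp
  \<comment> \<open>The accumulated bound \<open>sum\<close> is weak, as it includes j = 0;
    splitting off the last of the m steps keeps the inequality strict.\<close>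
  have "h (2 * m) < h m - real m * b"
  proof -
    obtain n where n: "m = Suc n" using \<open>2 \<le> m\<close> by (cases m) auto
    have "2 * m = Suc (m + n)" "real m * b = real n * b + b"
      using n by (auto simp: algebra_simps)
    moreover have "h (m + n) \<le> h m - real n * b" "h (Suc (m + n)) < h (m + n) - b"
      using sum[of n] strict[of n] n by simp_all
    ultimately show ?thesis by (simp only:)
  qed
  moreover have "0 \<le> h (2 * m)" using nonneg \<open>2 \<le> m\<close> by simp
  \<comment> \<open>Applying \<open>decay\<close> at \<open>m - 1\<close> requires
    \<open>m - 1\<close> to be at least 1, hence \<open>2 \<le> m\<close>.\<close>
  moreover have "h m \<le> 2 * C / (real m + 1)"
    using decay[of "m - 1"] \<open>2 \<le> m\<close> by (simp add: of_nat_diff add.commute)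
  moreover have "real m * b = \<delta> - 2 * C * real m / (real m + 1)\<^sup>2"
    using \<open>2 \<le> m\<close> by (simp add: b_def field_simps)
  moreover have "2 * C * real m / (real m + 1)\<^sup>2 \<le> 2 * C / (real m + 1)"
  proof -
    have "2 * C * real m \<le> 2 * C * (real m + 1)"
      using \<open>0 \<le> C\<close> by (intro mult_left_mono) auto
    then have "2 * C * real m / (real m + 1)\<^sup>2 \<le> 2 * C * (real m + 1) / (real m + 1)\<^sup>2"
      by (intro divide_right_mono) auto
    then show ?thesis by (simp add: power2_eq_square)
  qed
  ultimately show ?thesis by (simp add: add_divide_distrib)
qed

text \<open>The parabola has its vertex at \<open>G / a\<close>. If the vertex is at most 1,
  completing the square gives the claim; otherwise the parabola decreases up to 1, where the step is
  clipped.\<close>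

lemma demyanov_rubinov_step_optimal:
  fixes a G s :: real
  assumes "0 < a" "s \<le> 1" and \<eta>: "\<eta> = min (G / a) 1"
  shows "\<eta>\<^sup>2 * a / 2 - \<eta> * G \<le> s\<^sup>2 * a / 2 - s * G"
proof (cases "G \<le> a")
  case True
  then have "G = \<eta> * a" using assms by (simp add: min_def)
  then have "s\<^sup>2 * a / 2 - s * G - (\<eta>\<^sup>2 * a / 2 - \<eta> * G) = a / 2 * (s - \<eta>)\<^sup>2"
    by (simp add: power2_eq_square field_simps)
  also have "\<dots> \<ge> 0" using assms(1) by simp
  finally show ?thesis by simp
next
  case False
  then have "\<eta> = 1" using assms by (simp add: min_def)
  have "a * (1 + s) / 2 \<le> a" using assms by (simp add: field_simps)
  then have "0 \<le> G - a * (1 + s) / 2" using False by linarith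
  then have "0 \<le> (1 - s) * (G - a * (1 + s) / 2)"
    using assms by (intro mult_nonneg_nonneg) auto
  then show ?thesis using \<open>\<eta> = 1\<close> by (simp add: power2_eq_square field_simps)
qed

section \<open>One inner step for a general DC pair\<close>

text \<open>Convexity of \<open>f\<close> and \<open>g\<close> enters as first-order inequalities on
  \<open>D\<close>, matching the relative gradients. \<open>DR\<close> ties \<open>M\<close> to
  \<open>Lf\<close> so that the Demyanov-Rubinov step minimizes the very quadratic model used in the
  analysis.\<close>

locale dc_frank_wolfe =
  fixes D :: "'a::euclidean_space set"
    and f g :: "'a \<Rightarrow> real" and f' g' :: "'a \<Rightarrow> 'a"
    and rule :: step_rule and M Lf :: real
  assumes conv: "convex D" and comp: "compact D"
    and smooth: "smooth_fun_on M D f f'"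
    and f_ineq: "\<And>x y. x \<in> D \<Longrightarrow> y \<in> D \<Longrightarrow> f x + f' x \<bullet> (y - x) \<le> f y"
    and g_ineq: "\<And>x y. x \<in> D \<Longrightarrow> y \<in> D \<Longrightarrow> g x + g' x \<bullet> (y - x) \<le> g y"
    and DR: "rule = Demyanov_Rubinov \<Longrightarrow> 0 < Lf \<and> M = Lf"
begin

text \<open>The usual smoothness bound on the Frank-Wolfe curvature constant of \<open>f\<close>
  over \<open>D\<close>.\<close>

definition curvature :: real
  where "curvature = M * (diameter D)\<^sup>2"

lemma M_nonneg: "0 \<le> M"
  using smooth by (auto simp: smooth_fun_on_def lipschitz_on_def)

lemma curvature_nonneg: "0 \<le> curvature"
  using M_nonneg by (simp add: curvature_def)

lemma segment_mem: "x \<in> D \<Longrightarrow> z \<in> D \<Longrightarrow> 0 \<le> s \<Longrightarrow> s \<le> 1 \<Longrightarrow> x + s *\<^sub>R (z - x) \<in> D"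
  using convexD_alt[OF conv, of x z s] by (simp add: algebra_simps)

text \<open>The surrogate differs from \<open>f\<close> by an affine function, so it inherits the
  quadratic bound with the gradient shifted by \<open>g' y\<close>.\<close>

lemma surrogate_upper_bound:
  assumes "x \<in> D" "z \<in> D" "0 \<le> s" "s \<le> 1"
  shows "dc_surrogate f g g' y (x + s *\<^sub>R (z - x)) \<le>
    dc_surrogate f g g' y x + s * ((f' x - g' y) \<bullet> (z - x)) + s\<^sup>2 * (M * (norm (z - x))\<^sup>2) / 2"
proof -
  have "f (x + s *\<^sub>R (z - x)) \<le> f x + s * (f' x \<bullet> (z - x)) + s\<^sup>2 * (M * (norm (z - x))\<^sup>2) / 2"
    using smooth_fun_on_upper_bound[OF smooth conv \<open>x \<in> D\<close> segment_mem[OF assms]]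
    by (simp add: power_mult_distrib mult_ac)
  then show ?thesis
    by (simp add: dc_surrogate_def inner_diff_left inner_diff_right inner_add_right algebra_simps)
qed

lemma quadratic_le_curvature:
  assumes "x \<in> D" "z \<in> D"
  shows "s\<^sup>2 * (M * (norm (z - x))\<^sup>2) / 2 \<le> s\<^sup>2 * curvature / 2"
proof -
  have "norm (z - x) \<le> diameter D"
    using diameter_bounded_bound[OF compact_imp_bounded[OF comp] assms(2,1)]
    by (simp add: dist_norm)
  then have "M * (norm (z - x))\<^sup>2 \<le> curvature"
    unfolding curvature_def using M_nonneg by (intro mult_left_mono power_mono) auto
  then show ?thesis by (intro divide_right_mono mult_left_mono) auto
qed

text \<open>The open-loop step is the reference \<open>s\<close>; line search does at least as well
  on the surrogate itself, and Demyanov-Rubinov on its quadratic model. The positive gap excludes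
  \<open>z = x\<close>, where the Demyanov-Rubinov quotient would have denominator 0, and makes that
  step nonnegative.\<close>

lemma step_size_progress:
  assumes step: "step_size rule Lf f f' g g' y k x (z - x) \<eta>"
    and "1 \<le> k" and x: "x \<in> D" and z: "z \<in> D"
    and pos: "0 < - ((f' x - g' y) \<bullet> (z - x))"
  shows "0 \<le> \<eta> \<and> \<eta> \<le> 1 \<and>
    dc_surrogate f g g' y (x + \<eta> *\<^sub>R (z - x)) \<le> dc_surrogate f g g' y x
      - 2 / (real k + 1) * - ((f' x - g' y) \<bullet> (z - x)) + (2 / (real k + 1))\<^sup>2 * curvature / 2"
proof -
  define s where "s = 2 / (real k + 1)"
  define G where "G = - ((f' x - g' y) \<bullet> (z - x))"
  define a where "a = M * (norm (z - x))\<^sup>2"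
  have s: "0 \<le> s" "s \<le> 1" using \<open>1 \<le> k\<close> by (auto simp: s_def)
  have model: "dc_surrogate f g g' y (x + r *\<^sub>R (z - x)) \<le>
      dc_surrogate f g g' y x + (r\<^sup>2 * a / 2 - r * G)" if "0 \<le> r" "r \<le> 1" for r
    using surrogate_upper_bound[OF x z that, of y] by (simp add: G_def a_def)
  have curv: "s\<^sup>2 * a / 2 \<le> s\<^sup>2 * curvature / 2"
    unfolding a_def by (rule quadratic_le_curvature[OF x z])
  have "0 \<le> \<eta> \<and> \<eta> \<le> 1 \<and> dc_surrogate f g g' y (x + \<eta> *\<^sub>R (z - x)) \<le>
      dc_surrogate f g g' y x + (s\<^sup>2 * a / 2 - s * G)"
  proof (cases rule)
    case Open_Loop
    then have "\<eta> = s" using step by (simp add: s_def)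
    then show ?thesis using model[OF s] s by blast
  next
    case Exact_Line_Search
    then have "\<eta> \<in> {0..1}"
      and "dc_surrogate f g g' y (x + \<eta> *\<^sub>R (z - x)) \<le> dc_surrogate f g g' y (x + s *\<^sub>R (z - x))"
      using step s by (auto simp: is_arg_min_linorder)
    then show ?thesis using model[OF s] by force
  next
    case Demyanov_Rubinov
    have "z \<noteq> x" using pos by auto
    then have a: "0 < a" using DR[OF Demyanov_Rubinov] by (simp add: a_def)
    have \<eta>: "\<eta> = min (G / a) 1"
      using step Demyanov_Rubinov DR[OF Demyanov_Rubinov] by (simp add: G_def a_def)
    moreover have "0 < G / a" using a pos unfolding G_def by (rule divide_pos_pos[rotated])
    ultimately have "0 \<le> \<eta>" "\<eta> \<le> 1" by auto
    then show ?thesis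
      using model[of \<eta>] demyanov_rubinov_step_optimal[OF a s(2) \<eta>] by linarith
  qed
  then show ?thesis using curv unfolding s_def G_def by linarith
qed

text \<open>Convexity bounds the difference by the linear one, which the oracle answer maximizes.
  The comparison point \<open>z\<close> is arbitrary: a surrogate minimizer in the inner analysis,
  every point of \<open>D\<close> in the bound on the DC gap.\<close>

lemma surrogate_le_linear_gap:
  assumes "is_arg_min (\<lambda>z. (f' x - g' y) \<bullet> z) (\<lambda>z. z \<in> D) v" "x \<in> D" "z \<in> D"
  shows "dc_surrogate f g g' y x - dc_surrogate f g g' y z \<le> - ((f' x - g' y) \<bullet> (v - x))"
proof -
  have "(f' x - g' y) \<bullet> v \<le> (f' x - g' y) \<bullet> z"
    using assms by (simp add: is_arg_min_linorder)
  then show ?thesis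
    using f_ineq[OF assms(2,3)] by (simp add: dc_surrogate_def inner_diff_left inner_diff_right)
qed

lemma surrogate_attains_min:
  assumes "D \<noteq> {}"
  shows "\<exists>z\<in>D. \<forall>x\<in>D. dc_surrogate f g g' y z \<le> dc_surrogate f g g' y x"
proof -
  have "continuous_on D f"
    using smooth unfolding smooth_fun_on_def gradient_on_def
    by (meson continuous_on_eq_continuous_within has_derivative_continuous)
  then have "continuous_on D (dc_surrogate f g g' y)"
    unfolding dc_surrogate_def by (intro continuous_intros)
  then show ?thesis using continuous_attains_inf[OF comp assms] by blast
qed

section \<open>Inner termination and outer rate along a run\<close>

context
  fixes \<epsilon> :: real and x0 :: 'a and x :: "nat \<Rightarrow> 'a" and X S :: "nat \<Rightarrow> nat \<Rightarrow> 'a"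
  assumes run: "dc_fw_run D rule Lf f f' g g' \<epsilon> x0 x X S" and \<epsilon>: "0 < \<epsilon>" and x0: "x0 \<in> D"
begin

abbreviation stops :: "nat \<Rightarrow> nat \<Rightarrow> bool"
  where "stops \<equiv> inner_stop f' g' \<epsilon> x X S"

lemma run_oracle:
  assumes "1 \<le> k" "\<forall>j\<in>{1..<k}. \<not> stops t j"
  shows "is_arg_min (\<lambda>z. (f' (X t k) - g' (x t)) \<bullet> z) (\<lambda>z. z \<in> D) (S t k)"
  using run assms unfolding dc_fw_run_def by blast

lemma run_step:
  assumes "1 \<le> k" "\<forall>j\<in>{1..<k}. \<not> stops t j" "\<not> stops t k"
  shows "\<exists>\<eta>. step_size rule Lf f f' g g' (x t) k (X t k) (S t k - X t k) \<eta> \<and>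
    X t (Suc k) = X t k + \<eta> *\<^sub>R (S t k - X t k)"
  using run assms unfolding dc_fw_run_def by presburger

lemma run_stop:
  assumes "1 \<le> k" "\<forall>j\<in>{1..<k}. \<not> stops t j" "stops t k"
  shows "x (Suc t) = X t k"
  using run assms unfolding dc_fw_run_def by presburger

lemma inner_step:
  assumes "1 \<le> k" and before: "\<forall>j\<in>{1..<k}. \<not> stops t j" and "\<not> stops t k" and "X t k \<in> D"
  shows "X t (Suc k) \<in> D \<and>
    dc_surrogate f g g' (x t) (X t (Suc k)) \<le> dc_surrogate f g g' (x t) (X t k)
      - 2 / (real k + 1) * - ((f' (X t k) - g' (x t)) \<bullet> (S t k - X t k))
      + (2 / (real k + 1))\<^sup>2 * curvature / 2"
proof -
  obtain \<eta> where \<eta>: "step_size rule Lf f f' g g' (x t) k (X t k) (S t k - X t k) \<eta>"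
      "X t (Suc k) = X t k + \<eta> *\<^sub>R (S t k - X t k)"
    using run_step[OF assms(1-3)] by blast
  have S: "S t k \<in> D" using run_oracle[OF assms(1,2)] by (simp add: is_arg_min_linorder)
  have "0 < - ((f' (X t k) - g' (x t)) \<bullet> (S t k - X t k))"
    using \<open>\<not> stops t k\<close> \<epsilon> by (simp add: inner_stop_def)
  from step_size_progress[OF \<eta>(1) assms(1,4) S this] show ?thesis
    using segment_mem[OF assms(4) S, of \<eta>] by (simp add: \<eta>(2))
qed

lemma inner_iterate_mem:
  assumes "x t \<in> D"
  shows "1 \<le> k \<Longrightarrow> \<forall>j\<in>{1..<k}. \<not> stops t j \<Longrightarrow> X t k \<in> D"
proof (induction k rule: nat_induct_at_least)
  case base
  then show ?case using run assms by (simp add: dc_fw_run_def)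
next
  case (Suc k)
  then show ?case using inner_step[of k t] by simp
qed

text \<open>Without a stop before \<open>2 * m\<close>, all gaps there exceed
  \<open>\<epsilon> / 2\<close>, and the scalar recurrence contradicts the choice of
  \<open>m\<close>. The bound is the same for every \<open>t\<close>, which the total oracle count
  relies on.\<close>

lemma inner_loop_stops:
  assumes "x t \<in> D" "2 \<le> m" "8 * curvature \<le> \<epsilon> * (real m + 1)"
  shows "\<exists>k\<ge>1. k < 2 * m \<and> stops t k"
proof (rule ccontr)
  assume "\<not> ?thesis"
  then have none: "\<not> stops t k" if "1 \<le> k" "k < 2 * m" for k using that by blast
  then have before: "\<forall>j\<in>{1..<k}. \<not> stops t j" if "k \<le> 2 * m" for k using that by simp
  obtain z where z: "z \<in> D"
      "\<forall>w\<in>D. dc_surrogate f g g' (x t) z \<le> dc_surrogate f g g' (x t) w"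
    using surrogate_attains_min assms(1) by blast
  define h where "h k = dc_surrogate f g g' (x t) (X t k) - dc_surrogate f g g' (x t) z" for k
  define G where "G k = - ((f' (X t k) - g' (x t)) \<bullet> (S t k - X t k))" for k
  have mem: "X t k \<in> D" if "1 \<le> k" "k \<le> 2 * m" for k
    using inner_iterate_mem[OF assms(1) that(1) before[OF that(2)]] .
  have "\<epsilon> / 2 < 4 * curvature / (real m + 1)"
  proof (rule frank_wolfe_gap_recurrence[where h = h and G = G])
    fix k assume k: "1 \<le> k" "k < 2 * m"
    then have k': "k \<le> 2 * m" by simp
    show "h (Suc k) \<le> h k - 2 / (real k + 1) * G k + (2 / (real k + 1))\<^sup>2 * curvature / 2"
      using inner_step[OF k(1) before[OF k'] none[OF k] mem[OF k(1) k']]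
      by (simp add: h_def G_def)
    show "h k \<le> G k"
      unfolding h_def G_def
      by (rule surrogate_le_linear_gap[OF run_oracle[OF k(1) before[OF k']] mem[OF k(1) k'] z(1)])
    show "\<epsilon> / 2 < G k"
      using none[OF k] by (simp add: inner_stop_def G_def)
  next
    fix k assume "1 \<le> k" "k \<le> 2 * m"
    then show "0 \<le> h k" using z(2) mem by (simp add: h_def)
  qed (use \<epsilon> curvature_nonneg assms in auto)
  then show False using assms(3) by (simp add: field_simps)
qed

lemma inner_loop_terminates:
  assumes "x t \<in> D"
  shows "\<exists>k\<ge>1. stops t k"
proof -
  obtain n where "8 * curvature / \<epsilon> \<le> real n" using real_arch_simple by blast
  then have "8 * curvature / \<epsilon> \<le> real (max 2 n) + 1" by linarith
  then have "8 * curvature \<le> \<epsilon> * (real (max 2 n) + 1)"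
    using \<epsilon> by (simp only: pos_divide_le_eq mult.commute)
  then show ?thesis using inner_loop_stops[OF assms, of "max 2 n"] by auto
qed

lemma outer_step:
  assumes "x t \<in> D"
  shows "x (Suc t) \<in> D"
    and "gap_DC D f g' (x t) \<le> (f (x t) - g (x t)) - (f (x (Suc t)) - g (x (Suc t))) + \<epsilon> / 2"
proof -
  \<comment> \<open>The run ties \<open>x (Suc t)\<close> to the first inner iterate that passes the
    test, so the least such \<open>k\<close> is taken.\<close>
  obtain k where k: "1 \<le> k" "stops t k" and least: "\<forall>j<k. \<not> (1 \<le> j \<and> stops t j)"
    using inner_loop_terminates[OF assms] exists_least_iff[of "\<lambda>k. 1 \<le> k \<and> stops t k"] by blast
  have before: "\<forall>j\<in>{1..<k}. \<not> stops t j"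
    using least by simp
  have next_eq: "x (Suc t) = X t k" using run_stop[OF k(1) before k(2)] .
  show mem: "x (Suc t) \<in> D"
    using inner_iterate_mem[OF assms k(1) before] next_eq by simp
  show "gap_DC D f g' (x t) \<le> (f (x t) - g (x t)) - (f (x (Suc t)) - g (x (Suc t))) + \<epsilon> / 2"
    unfolding gap_DC_def
  proof (rule cSUP_least)
    fix z assume "z \<in> D"
    then have "dc_surrogate f g g' (x t) (x (Suc t)) - dc_surrogate f g g' (x t) z \<le> \<epsilon> / 2"
      using surrogate_le_linear_gap[OF run_oracle[OF k(1) before], of z] k(2) mem next_eq
      by (simp add: inner_stop_def)
    then show "f (x t) - f z - g' (x t) \<bullet> (x t - z)
        \<le> (f (x t) - g (x t)) - (f (x (Suc t)) - g (x (Suc t))) + \<epsilon> / 2"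
      \<comment> \<open>Convexity of \<open>g\<close> replaces its linearization at
        \<open>x t\<close>, evaluated at \<open>x (Suc t)\<close>, by the value
        \<open>g (x (Suc t))\<close>; this turns the decrease of the surrogate into a decrease of
        \<open>f - g\<close>.\<close>
      using g_ineq[OF assms mem] by (simp add: dc_surrogate_def inner_diff_right)
  qed (use assms in blast)
qed

lemma outer_iterate_mem: "x t \<in> D"
proof (induction t)
  case 0
  then show ?case using run x0 by (simp add: dc_fw_run_def)
qed (rule outer_step)

lemma sum_gap_le:
  "(\<Sum>\<tau>\<le>t. gap_DC D f g' (x \<tau>))
    \<le> (f x0 - g x0) - (f (x (Suc t)) - g (x (Suc t))) + (real t + 1) * (\<epsilon> / 2)"
proof (induction t)
  case 0
  have "x 0 = x0" using run by (simp add: dc_fw_run_def)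
  then show ?case using outer_step(2)[OF outer_iterate_mem, of 0] by simp
next
  case (Suc t)
  moreover have "(real (Suc t) + 1) * (\<epsilon> / 2) = (real t + 1) * (\<epsilon> / 2) + \<epsilon> / 2"
    by (simp add: field_simps)
  ultimately show ?case
    using outer_step(2)[OF outer_iterate_mem, of "Suc t"] unfolding sum.atMost_Suc by linarith
qed

text \<open>The minimum is at most the average, and the telescoped sum is controlled by any lower
  bound \<open>b\<close> of the objective.\<close>

lemma min_gap_le:
  assumes "\<And>z. z \<in> D \<Longrightarrow> b \<le> f z - g z"
  shows "(MIN \<tau>\<in>{0..t}. gap_DC D f g' (x \<tau>)) \<le> (f x0 - g x0 - b) / (real t + 1) + \<epsilon> / 2"
proof -
  let ?m = "MIN \<tau>\<in>{0..t}. gap_DC D f g' (x \<tau>)"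
  have "(real t + 1) * ?m = (\<Sum>\<tau>\<le>t. ?m)" by simp
  also have "\<dots> \<le> (\<Sum>\<tau>\<le>t. gap_DC D f g' (x \<tau>))"
    by (intro sum_mono Min_le) auto
  also have "\<dots> \<le> f x0 - g x0 - b + (real t + 1) * (\<epsilon> / 2)"
    using sum_gap_le[of t] assms[OF outer_iterate_mem, of "Suc t"] by linarith
  finally have "?m \<le> (f x0 - g x0 - b + (real t + 1) * (\<epsilon> / 2)) / (real t + 1)"
    by (simp add: le_divide_eq mult.commute)
  also have "\<dots> = (f x0 - g x0 - b) / (real t + 1) + \<epsilon> / 2"
  proof -
    have "(real t + 1) * (\<epsilon> / 2) / (real t + 1) = \<epsilon> / 2"
      by (rule nonzero_mult_div_cancel_left) simp
    then show ?thesis by (simp only: add_divide_distrib)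
  qed
  finally show ?thesis .
qed

lemma inner_iters_le:
  assumes "2 \<le> m" "8 * curvature \<le> \<epsilon> * (real m + 1)"
  shows "inner_iters f' g' \<epsilon> x X S t \<le> 2 * m"
proof -
  obtain k where "1 \<le> k" "k < 2 * m" "stops t k"
    using inner_loop_stops[OF outer_iterate_mem assms] by blast
  then have "inner_iters f' g' \<epsilon> x X S t \<le> k"
    unfolding inner_iters_def by (intro Least_le) blast
  then show ?thesis using \<open>k < 2 * m\<close> by simp
qed

end

end

section \<open>Oracle counts and their asymptotics\<close>

lemma length_grad_queries:
  "length (grad_queries f' g' \<epsilon> x X S T) = (\<Sum>t<T. inner_iters f' g' \<epsilon> x X S t)"
  by (simp add: grad_queries_def length_concat o_def interv_sum_list_conv_sum_set_nat
      atLeast0LessThan del: upt_Suc)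

lemma length_lmo_queries:
  "length (lmo_queries f' g' \<epsilon> x X S T) = (\<Sum>t<T. inner_iters f' g' \<epsilon> x X S t)"
  by (simp add: lmo_queries_def length_concat o_def interv_sum_list_conv_sum_set_nat
      atLeast0LessThan del: upt_Suc)

lemma nat_ceiling_divide_bigo:
  fixes c :: real
  assumes "0 \<le> c"
  shows "(\<lambda>\<epsilon>. real (nat \<lceil>c / \<epsilon>\<rceil> + n)) \<in> O[at_right 0](\<lambda>\<epsilon>. 1 / \<epsilon>)"
proof (rule bigoI[of _ "c + 1 + real n"])
  \<comment> \<open>Below 1, the rounding error and the constant \<open>n\<close> are absorbed into
    a multiple of \<open>1 / \<epsilon>\<close>.\<close>
  have "\<forall>\<^sub>F \<epsilon> in at_right 0. \<epsilon> \<in> {0<..<1::real}"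
    by (rule eventually_at_right_real) simp
  then show "\<forall>\<^sub>F \<epsilon> in at_right 0. norm (real (nat \<lceil>c / \<epsilon>\<rceil> + n)) \<le> (c + 1 + real n) * norm (1 / \<epsilon>)"
  proof eventually_elim
    case (elim \<epsilon>)
    then have "0 \<le> c / \<epsilon>" using assms by simp
    then have "real (nat \<lceil>c / \<epsilon>\<rceil>) \<le> c / \<epsilon> + 1" by linarith
    moreover have "1 + real n \<le> (1 + real n) / \<epsilon>"
      using elim mult_left_le[of \<epsilon> "1 + real n"] by (simp add: le_divide_eq)
    ultimately have "real (nat \<lceil>c / \<epsilon>\<rceil> + n) \<le> c / \<epsilon> + (1 + real n) / \<epsilon>" by simp
    then show ?case using elim by (simp add: add_divide_distrib)
  qed
qed

section \<open>The convergence rate and complexity for the given decomposition\<close>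

theorem theorem12:
  fixes D :: "'a::euclidean_space set"
    and \<phi> f g :: "'a \<Rightarrow> real"
    and \<phi>' f' g' :: "'a \<Rightarrow> 'a"
    and L Lf :: real
    and x0 xstar :: 'a
    and rule :: step_rule
  assumes "D \<noteq> {}" "convex D" "compact D"
    and "smooth_fun_on L D \<phi> \<phi>'"
    and "is_arg_min \<phi> (\<lambda>x. x \<in> D) xstar"
    and "x0 \<in> D"
    and "f = (\<lambda>x. \<phi> x + L / 2 * (norm x)\<^sup>2)"
    and "f' = (\<lambda>x. \<phi>' x + L *\<^sub>R x)"
    and "g = (\<lambda>x. L / 2 * (norm x)\<^sup>2)"
    and "g' = (\<lambda>x. L *\<^sub>R x)"
    and "rule = Demyanov_Rubinov \<longrightarrow> 0 < Lf \<and> smooth_fun_on Lf D f f'"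
  shows "(\<forall>\<epsilon>>0. \<forall>x X S. dc_fw_run D rule Lf f f' g g' \<epsilon> x0 x X S \<longrightarrow>
            (\<forall>t. \<exists>k\<ge>1. inner_stop f' g' \<epsilon> x X S t k) \<and>
            (\<forall>t. (MIN \<tau>\<in>{0..t}. gap_DC D f g' (x \<tau>))
                   \<le> (\<phi> x0 - \<phi> xstar) / (real t + 1) + \<epsilon> / 2))
       \<and> (\<exists>N G M :: real \<Rightarrow> nat.
            (\<lambda>\<epsilon>. real (N \<epsilon>)) \<in> O[at_right 0](\<lambda>\<epsilon>. 1 / \<epsilon>) \<and>
            (\<lambda>\<epsilon>. real (G \<epsilon>)) \<in> O[at_right 0](\<lambda>\<epsilon>. 1 / \<epsilon>\<^sup>2) \<and>
            (\<lambda>\<epsilon>. real (M \<epsilon>)) \<in> O[at_right 0](\<lambda>\<epsilon>. 1 / \<epsilon>\<^sup>2) \<and>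
            (\<forall>\<epsilon>>0. \<forall>x X S. dc_fw_run D rule Lf f f' g g' \<epsilon> x0 x X S \<longrightarrow>
               (\<exists>\<tau>\<le>N \<epsilon>. gap_DC D f g' (x \<tau>) \<le> \<epsilon>) \<and>
               length (grad_queries f' g' \<epsilon> x X S (N \<epsilon>)) \<le> G \<epsilon> \<and>
               length (lmo_queries f' g' \<epsilon> x X S (N \<epsilon>)) \<le> M \<epsilon>))"
proof -
  \<comment> \<open>The decomposition yields the constant \<open>2 * L\<close>; under
    Demyanov-Rubinov the analysis must use the constant of the rule itself.\<close>
  define M where "M = (if rule = Demyanov_Rubinov then Lf else 2 * L)"
  have L: "0 \<le> L"
    using assms(4) by (auto simp: smooth_fun_on_def lipschitz_on_def)
  have \<phi>: "\<phi> x = f x - g x" for x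
    by (simp add: assms(7,9))
  interpret dc_frank_wolfe D f g f' g' rule M Lf
  proof
    show "smooth_fun_on M D f f'"
      using assms(11) smooth_fun_on_add_half_norm_sq[OF assms(4)]
      by (simp add: M_def assms(7,8))
    show "f x + f' x \<bullet> (y - x) \<le> f y" if "x \<in> D" "y \<in> D" for x y
      using add_half_norm_sq_gradient_ineq[OF assms(4,2) that] by (simp add: assms(7,8))
    show "g x + g' x \<bullet> (y - x) \<le> g y" if "x \<in> D" "y \<in> D" for x y
      using norm_sq_expand[of L y x] L by (simp add: assms(9,10))
  qed (use assms(2,3,11) in \<open>auto simp: M_def\<close>)
  have lower: "\<phi> xstar \<le> f z - g z" if "z \<in> D" for z
    using assms(5) that by (simp add: is_arg_min_linorder flip: \<phi>)
  define \<Delta> where "\<Delta> = \<phi> x0 - \<phi> xstar"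
  have \<Delta>: "0 \<le> \<Delta>" using lower[OF assms(6)] by (simp add: \<Delta>_def \<phi>)
  have rate: "(MIN \<tau>\<in>{0..t}. gap_DC D f g' (x \<tau>)) \<le> \<Delta> / (real t + 1) + \<epsilon> / 2"
    if "0 < \<epsilon>" "dc_fw_run D rule Lf f f' g g' \<epsilon> x0 x X S" for \<epsilon> x X S t
    using min_gap_le[OF that(2,1) assms(6) lower] by (simp add: \<Delta>_def \<phi>)
  \<comment> \<open>Chosen so that \<open>\<Delta> / (N \<epsilon> + 1)\<close> is at most
    \<open>\<epsilon> / 2\<close>, the half of the accuracy left over by the inner
    tolerance.\<close>
  define N :: "real \<Rightarrow> nat" where "N \<epsilon> = nat \<lceil>2 * \<Delta> / \<epsilon>\<rceil>" for \<epsilon>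
  \<comment> \<open>The ceiling meets the curvature condition of \<open>inner_iters_le\<close>, and
    the added 2 its condition \<open>2 \<le> m\<close>.\<close>
  define m :: "real \<Rightarrow> nat" where "m \<epsilon> = nat \<lceil>8 * curvature / \<epsilon>\<rceil> + 2" for \<epsilon>
  \<comment> \<open>The outer iterations 0 to \<open>N \<epsilon> - 1\<close> already produce the
    iterates up to \<open>x (N \<epsilon>)\<close>. Each has at most \<open>2 * m \<epsilon>\<close>
    inner iterations, with one gradient and one oracle call apiece, so one bound serves both
    counts.\<close>
  define Q where "Q \<epsilon> = N \<epsilon> * (2 * m \<epsilon>)" for \<epsilon>
  have N_bigo: "(\<lambda>\<epsilon>. real (N \<epsilon>)) \<in> O[at_right 0](\<lambda>\<epsilon>. 1 / \<epsilon>)"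
    using nat_ceiling_divide_bigo[of "2 * \<Delta>" 0] \<Delta> by (simp add: N_def)
  have m_bigo: "(\<lambda>\<epsilon>. real (m \<epsilon>)) \<in> O[at_right 0](\<lambda>\<epsilon>. 1 / \<epsilon>)"
    unfolding m_def using curvature_nonneg by (intro nat_ceiling_divide_bigo) simp
  have "(\<lambda>\<epsilon>. real (N \<epsilon>) * (2 * real (m \<epsilon>))) \<in> O[at_right 0](\<lambda>\<epsilon>. 1 / \<epsilon> * (1 / \<epsilon>))"
    using N_bigo m_bigo by (intro landau_o.big.mult) simp_all
  then have Q_bigo: "(\<lambda>\<epsilon>. real (Q \<epsilon>)) \<in> O[at_right 0](\<lambda>\<epsilon>. 1 / \<epsilon>\<^sup>2)"
    by (simp add: Q_def power2_eq_square)
  have small_gap: "\<exists>\<tau>\<le>N \<epsilon>. gap_DC D f g' (x \<tau>) \<le> \<epsilon>"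
    if "0 < \<epsilon>" "dc_fw_run D rule Lf f f' g g' \<epsilon> x0 x X S" for \<epsilon> x X S
  proof -
    have "2 * \<Delta> / \<epsilon> \<le> real (N \<epsilon>) + 1" unfolding N_def by linarith
    then have "\<Delta> / (real (N \<epsilon>) + 1) \<le> \<epsilon> / 2"
      using that(1) by (simp add: field_simps)
    then have "(MIN \<tau>\<in>{0..N \<epsilon>}. gap_DC D f g' (x \<tau>)) \<le> \<epsilon>"
      using rate[OF that, of "N \<epsilon>"] by linarith
    moreover have "(MIN \<tau>\<in>{0..N \<epsilon>}. gap_DC D f g' (x \<tau>)) \<in> (\<lambda>\<tau>. gap_DC D f g' (x \<tau>)) ` {0..N \<epsilon>}"
      by (intro Min_in) auto
    ultimately show ?thesis by force
  qed
  have iters: "(\<Sum>t<N \<epsilon>. inner_iters f' g' \<epsilon> x X S t) \<le> Q \<epsilon>"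
    if "0 < \<epsilon>" "dc_fw_run D rule Lf f f' g g' \<epsilon> x0 x X S" for \<epsilon> x X S
  proof -
    have "8 * curvature / \<epsilon> \<le> real (m \<epsilon>) + 1" unfolding m_def by linarith
    then have "8 * curvature \<le> \<epsilon> * (real (m \<epsilon>) + 1)"
      using that(1) by (simp add: field_simps)
    then have "inner_iters f' g' \<epsilon> x X S t \<le> 2 * m \<epsilon>" for t
      by (intro inner_iters_le[OF that(2,1) assms(6)]) (auto simp: m_def)
    then have "(\<Sum>t<N \<epsilon>. inner_iters f' g' \<epsilon> x X S t) \<le> (\<Sum>t<N \<epsilon>. 2 * m \<epsilon>)"
      by (intro sum_mono)
    then show ?thesis by (simp add: Q_def)
  qed
  have terminates: "\<exists>k\<ge>1. inner_stop f' g' \<epsilon> x X S t k"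
    if "0 < \<epsilon>" "dc_fw_run D rule Lf f f' g g' \<epsilon> x0 x X S" for \<epsilon> x X S t
    using inner_loop_terminates[OF that(2,1) assms(6)] outer_iterate_mem[OF that(2,1) assms(6)]
    by blast
  show ?thesis
    unfolding length_grad_queries length_lmo_queries \<Delta>_def[symmetric]
    by (rule conjI, use terminates rate in blast,
        rule exI[of _ N], rule exI[of _ Q], rule exI[of _ Q],
        use N_bigo Q_bigo small_gap iters in blast)
qed

end
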